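(* Let $L>0$, let $I=[0,T)$ with $0<T\le\infty$, and let $u_0\in X_1$. Suppose that $u$ and $q$ are functions of $t\in I$ with $u(\cdot,t)\in X_1$ and $q(\cdot,t)\in X_2$ for all $t\in I$, with $u(\cdot,0)=u_0$, such that for every $t\in I$ and for all $v_1\in X_1$ and $v_2\in X_2$, $$\left(u_{xt},(v_1)_x\right)=\left(q u_x+(qu)_x,\,v_1\right),$$ $$\left(q,v_2\right)=-\left(u_x,(v_2)_x\right).$$ Assume that $u_t\in X_1$ (for every $t\in I$). Then $$\frac{\mathrm{d}}{\mathrm{d}t}\mathcal{H}_1(u)=0 .$$
   Context: All functions are real-valued. $H^1(-L,L)$ is the usual first-order Sobolev space on $(-L,L)$ and $$X_1=\{v\in H^1(-L,L)\mid v(-L)=0\},\qquad X_2=\{v\in H^1(-L,L)\mid v(L)=0\}.$$ The bracket is $(f,g)=\int_{-L}^{L} f g\,\mathrm{d}x$. Subscripts $x$ and $t$ denote differentiation in space and in time; the time derivative $u_t$ is the derivative of $t\mapsto u(\cdot,t)$ as an $X_1$-valued map (with the $H^1$ norm), and $u_{xt}=(u_t)_x$. The energy (first Hamiltonian) is $$\mathcal{H}_1(u)=\frac12\int_{-L}^{L}u_x^2\,\mathrm{d}x .$$ The system is an $H^1$-weak form of the Hunter--Saxton equation $u_{xxt}+2u_xu_{xx}+uu_{xxx}=0$ on $(-L,L)$, with $q$ playing the role of $u_{xx}$. *)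

theory Defs
  imports "HOL-Analysis.Analysis"
begin

abbreviation dom_meas :: "real \<Rightarrow> real measure" where
  "dom_meas L \<equiv> lebesgue_on {-L<..<L}"

definition L2 :: "real \<Rightarrow> (real \<Rightarrow> real) set" where
  "L2 L = {f \<in> borel_measurable (dom_meas L). integrable (dom_meas L) (\<lambda>x. (f x)\<^sup>2)}"

definition bracket :: "real \<Rightarrow> (real \<Rightarrow> real) \<Rightarrow> (real \<Rightarrow> real) \<Rightarrow> real" where
  "bracket L f g = (LINT x|dom_meas L. f x * g x)"

definition test_fun :: "real \<Rightarrow> (real \<Rightarrow> real) \<Rightarrow> bool" where
  "test_fun L \<phi> \<longleftrightarrow>
     (\<forall>k. (deriv ^^ k) \<phi> differentiable_on UNIV) \<and>
     compact (closure {x. \<phi> x \<noteq> 0}) \<and> closure {x. \<phi> x \<noteq> 0} \<subseteq> {-L<..<L}"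

definition has_weak_deriv :: "real \<Rightarrow> (real \<Rightarrow> real) \<Rightarrow> (real \<Rightarrow> real) \<Rightarrow> bool" where
  "has_weak_deriv L f g \<longleftrightarrow> f \<in> L2 L \<and> g \<in> L2 L \<and>
     (\<forall>\<phi>. test_fun L \<phi> \<longrightarrow> bracket L f (deriv \<phi>) = - bracket L g \<phi>)"

text \<open>Elements of the function spaces are represented by functions; two functions that agree
  almost everywhere on \<open>(-L, L)\<close> represent the same element. Values outside \<open>(-L, L)\<close>
  are irrelevant.\<close>

definition H1 :: "real \<Rightarrow> (real \<Rightarrow> real) set" where
  "H1 L = {f. \<exists>g. has_weak_deriv L f g}"

text \<open>The weak derivative \<open>f\<^sub>x\<close> of \<open>f \<in> H1 L\<close>; it is determined almost everywhere,
  and is used only inside integrals.\<close>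

definition wderiv :: "real \<Rightarrow> (real \<Rightarrow> real) \<Rightarrow> real \<Rightarrow> real" where
  "wderiv L f = (SOME g. has_weak_deriv L f g)"

definition H1_norm :: "real \<Rightarrow> (real \<Rightarrow> real) \<Rightarrow> real" where
  "H1_norm L f = sqrt (bracket L f f + bracket L (wderiv L f) (wderiv L f))"

text \<open>Point values of an \<open>H\<^sup>1\<close> function are those of its continuous representative on the
  closed interval.\<close>

definition continuous_rep :: "real \<Rightarrow> (real \<Rightarrow> real) \<Rightarrow> (real \<Rightarrow> real) \<Rightarrow> bool" where
  "continuous_rep L f g \<longleftrightarrow> continuous_on {-L..L} g \<and> (AE x in dom_meas L. f x = g x)"

definition X1 :: "real \<Rightarrow> (real \<Rightarrow> real) set" where
  "X1 L = {v \<in> H1 L. \<exists>g. continuous_rep L v g \<and> g (-L) = 0}"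

definition X2 :: "real \<Rightarrow> (real \<Rightarrow> real) set" where
  "X2 L = {v \<in> H1 L. \<exists>g. continuous_rep L v g \<and> g L = 0}"

text \<open>\<open>w\<close> is the derivative at time \<open>t\<close>, relative to the time set \<open>I\<close>, of the curve
  \<open>s \<mapsto> u s\<close> in \<open>X1 L\<close> with the \<open>H\<^sup>1\<close> norm.
  It is one-sided when \<open>t\<close> is an endpoint of \<open>I\<close>.\<close>

definition has_X1_time_deriv ::
  "real \<Rightarrow> (real \<Rightarrow> real \<Rightarrow> real) \<Rightarrow> (real \<Rightarrow> real) \<Rightarrow> real \<Rightarrow> real set \<Rightarrow> bool" where
  "has_X1_time_deriv L u w t I \<longleftrightarrow> w \<in> X1 L \<and>
     ((\<lambda>s. H1_norm L (\<lambda>x. (u s x - u t x) / (s - t) - w x)) \<longlongrightarrow> 0) (at t within I)"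

definition Ham1 :: "real \<Rightarrow> (real \<Rightarrow> real) \<Rightarrow> real" where
  "Ham1 L v = 1 / 2 * (LINT x|dom_meas L. (wderiv L v x)\<^sup>2)"

end

theory Submission
  imports Defs
begin

text \<open>
  Formally \<open>d/dt H\<^sub>1(u) = (u\<^sub>x, u\<^sub>x\<^sub>t)\<close>, and choosing \<open>v\<^sub>1 = u\<close> in the evolution equation turns
  this into \<open>(q u\<^sub>x + (q u)\<^sub>x, u)\<close>. The integrand is a total derivative:
  \<open>q u\<^sub>x u + (q u)\<^sub>x u = ((q u) u)\<^sub>x\<close>. Hence the integral is the difference of the values of
  \<open>q u\<^sup>2\<close> at the two ends, and both vanish: \<open>q\<close> is zero at \<open>L\<close> and \<open>u\<close> is zero at \<open>-L\<close>.

  The work lies in justifying this for functions that are only in \<open>H\<^sup>1\<close>. The total derivative is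
  handled with absolutely continuous functions, described by \<open>has_ac_deriv\<close>: a function is the
  indefinite Lebesgue integral of an integrable density, up to a constant. They are closed under
  products (\<open>has_ac_deriv_mult\<close>, which is Fubini's theorem on a square cut along its diagonal), so
  triple products such as \<open>q u u\<close> and \<open>q u \<phi>\<close> with a test function \<open>\<phi>\<close> are available at once. Two
  facts connect them with weak derivatives. An \<open>H\<^sup>1\<close> function agrees almost everywhere with an
  absolutely continuous one whose density is its weak derivative (\<open>weak_deriv_imp_ac\<close>), and
  conversely a square-integrable density is a weak derivative (\<open>ac_imp_weak_deriv\<close>); the boundary
  values in \<open>X1\<close> and \<open>X2\<close> are then those of the absolutely continuous representative
  (\<open>H1_ac_rep\<close>). The cancellation itself is \<open>flux_vanishes\<close>.

  The representation theorem rests on the fundamental lemma of the calculus of variations and the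
  lemma of du Bois-Reymond. These need enough smooth compactly supported functions, which are built
  from \<open>exp (-1/x)\<close>.

  Finally, \<open>H\<^sub>1\<close> is a quadratic form in \<open>u\<^sub>x\<close>, so differentiability of \<open>u\<close> in the \<open>H\<^sup>1\<close> norm
  gives the derivative \<open>(u\<^sub>x\<^sub>t, u\<^sub>x)\<close> of the energy (\<open>has_real_derivative_Ham1\<close>).
\<close>

section \<open>Functions with vanishing integrals over intervals\<close>

text \<open>
  The sets over which \<open>k\<close> has integral zero form a Dynkin system containing the open intervals,
  hence all Borel sets; a Lebesgue set differs from a Borel set by a null set.
\<close>

lemma AE_zero_if_interval_integrals_zero:
  fixes k :: "real \<Rightarrow> real"
  assumes int: "integrable lebesgue k"
    and zero: "\<And>a b. (LINT x|lebesgue. indicator {a<..<b} x * k x) = 0"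
  shows "AE x in lebesgue. k x = 0"
proof (rule sigma_finite_measure.density_zero[OF _ int])
  show "sigma_finite_measure (lebesgue :: real measure)"
    unfolding sigma_finite_measure_def
  proof -
    obtain A :: "real set set" where A: "countable A" "A \<subseteq> sets lborel" "\<Union>A = space lborel"
      "\<forall>a\<in>A. emeasure lborel a \<noteq> \<infinity>"
      using lborel.sigma_finite_countable by blast
    thus "\<exists>A. countable A \<and> A \<subseteq> sets (lebesgue :: real measure) \<and> \<Union>A = space lebesgue \<and>
        (\<forall>a\<in>A. emeasure lebesgue a \<noteq> \<infinity>)"
      by (intro exI[of _ A]) auto
  qed
  have total: "(LINT x|lebesgue. k x) = 0"
  proof -
    have "(\<lambda>n. LINT x|lebesgue. indicator {- real n<..<real n} x * k x) \<longlonglongrightarrow> (LINT x|lebesgue. k x)"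
    proof (rule integral_dominated_convergence[where w="\<lambda>x. \<bar>k x\<bar>"])
      show "AE x in lebesgue. (\<lambda>n. indicator {- real n<..<real n} x * k x) \<longlonglongrightarrow> k x"
      proof (rule AE_I2)
        fix x :: real
        obtain N where "\<bar>x\<bar> < real N" using reals_Archimedean2 by blast
        hence "\<forall>\<^sub>F n in sequentially. k x = indicator {- real n<..<real n} x * k x"
          by (intro eventually_sequentiallyI[of N]) (auto simp: indicator_def)
        thus "(\<lambda>n. indicator {- real n<..<real n} x * k x) \<longlonglongrightarrow> k x"
          by (rule Lim_transform_eventually[OF tendsto_const])
      qed
      show "(\<lambda>x. indicator {- real n<..<real n} x * k x) \<in> borel_measurable lebesgue" for n
        using int by (intro borel_measurable_times borel_measurable_indicator) auto
    qed (use int in \<open>auto simp: indicator_def\<close>)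
    thus ?thesis using zero by (simp add: LIMSEQ_const_iff)
  qed
  have set_int: "set_integrable lebesgue A k" if "A \<in> sets lebesgue" for A
    unfolding set_integrable_def using int that by (rule integrable_mult_indicator[rotated])
  have borel: "(LINT x:A|lebesgue. k x) = 0" if "A \<in> sets borel" for A
  proof -
    let ?G = "range (\<lambda>(a, b). {a<..<b :: real})"
    have sets_G: "sets borel = sigma_sets UNIV ?G"
      using arg_cong[OF borel_eq_box[where 'a=real], of sets] unfolding box_real by simp
    have "Int_stable ?G"
      unfolding Int_stable_def by (auto simp: image_iff)
    moreover have "?G \<subseteq> Pow UNIV" by simp
    moreover have "A \<in> sigma_sets UNIV ?G" using that sets_G by simp
    ultimately show ?thesis
    proof (induction rule: sigma_sets_induct_disjoint)
      case (basic A)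
      thus ?case using zero by (auto simp: set_lebesgue_integral_def)
    next
      case empty
      show ?case by (simp add: set_lebesgue_integral_def)
    next
      case (compl A)
      hence A: "A \<in> sets lebesgue" using sets_G by auto
      have "(LINT x:UNIV - A|lebesgue. k x) = (LINT x|lebesgue. k x - indicator A x * k x)"
        unfolding set_lebesgue_integral_def
        by (intro Bochner_Integration.integral_cong) (auto simp: indicator_def)
      also have "\<dots> = (LINT x|lebesgue. k x) - (LINT x:A|lebesgue. k x)"
        using set_int[OF A] int
        by (simp add: set_lebesgue_integral_def set_integrable_def)
      finally show ?case using compl total by simp
    next
      case (union A)
      have "A i \<in> sets borel" for i using union.hyps unfolding sets_G by auto
      hence A: "A i \<in> sets lebesgue" for i by simp
      have "(LINT x:(\<Union>i. A i)|lebesgue. k x) = (\<Sum>i. LINT x:A i|lebesgue. k x)"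
        using union.hyps A set_int[of "\<Union>i. A i"]
        by (intro lebesgue_integral_countable_add) (auto simp: disjoint_family_on_def)
      thus ?case using union.IH by simp
    qed
  qed
  fix A :: "real set" assume "A \<in> sets lebesgue"
  then obtain S N N' where A: "A = S \<union> N" "N \<subseteq> N'" "N' \<in> null_sets lborel" "S \<in> sets lborel"
    by (rule sets_completionE)
  have N: "N' \<in> null_sets lebesgue" using A(3) by (rule null_sets_completionI)
  have "(LINT x:A|lebesgue. k x) = (LINT x:S|lebesgue. k x)"
  proof (rule set_integral_cong_set)
    show "AE x in lebesgue. (x \<in> S) = (x \<in> A)"
      using AE_not_in[OF N] by eventually_elim (use A in auto)
  qed (use set_int[of A] set_int[of S] \<open>A \<in> sets lebesgue\<close> A(4) in
        \<open>auto simp: set_integrable_def set_borel_measurable_def\<close>)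
  thus "(LINT x:A|lebesgue. k x) = 0" using borel A(4) by simp
qed

section \<open>Smooth functions with compact support\<close>

text \<open>
  The family is indexed by \<open>n\<close> because differentiating \<open>exp (-1/x) / x ^ n\<close> only changes the
  exponent: all derivatives of the classical flat function \<open>flat 0\<close> are combinations of members
  of the family.
\<close>

definition flat :: "nat \<Rightarrow> real \<Rightarrow> real" where
  "flat n x = (if x > 0 then exp (- (1 / x)) / x ^ n else 0)"

lemma flat_tendsto_0: "(flat n \<longlongrightarrow> 0) (at 0)"
proof -
  have "(((\<lambda>y::real. y ^ n / exp y) \<circ> inverse) \<longlongrightarrow> 0) (at_right 0)"
    unfolding comp_def
    by (rule filterlim_compose[OF tendsto_power_div_exp_0 filterlim_inverse_at_top_right])
  moreover have "\<forall>\<^sub>F x in at_right 0. ((\<lambda>y::real. y ^ n / exp y) \<circ> inverse) x = flat n x"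
    unfolding eventually_at_right_field
    by (intro exI[of _ 1]) (auto simp: flat_def exp_minus field_simps)
  ultimately have "(flat n \<longlongrightarrow> 0) (at_right 0)"
    by (rule Lim_transform_eventually)
  moreover have "\<forall>\<^sub>F x in at_left 0. 0 = flat n x"
    unfolding eventually_at_left_field by (intro exI[of _ "-1"]) (auto simp: flat_def)
  hence "(flat n \<longlongrightarrow> 0) (at_left 0)"
    using tendsto_const by (rule Lim_transform_eventually[rotated])
  ultimately show ?thesis
    by (simp add: filterlim_split_at_real)
qed

lemma has_real_derivative_flat:
  "(flat n has_real_derivative (flat (n + 2) x - real n * flat (n + 1) x)) (at x)"
proof -
  consider "x < 0" | "x = 0" | "x > 0" by linarith
  thus ?thesis
  proof cases
    case 1
    have "((\<lambda>_. 0) has_real_derivative 0) (at x)" by simp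
    hence "(flat n has_real_derivative 0) (at x)"
      by (rule has_field_derivative_transform_within_open[where S="{..<0}"])
         (use 1 in \<open>auto simp: flat_def\<close>)
    thus ?thesis using 1 by (simp add: flat_def)
  next
    case 2
    have "((\<lambda>h. (flat n (0 + h) - flat n 0) / h) \<longlongrightarrow> 0) (at 0)"
      using flat_tendsto_0[of "Suc n"] by (rule Lim_transform_eventually) (auto simp: flat_def)
    thus ?thesis using 2 by (simp add: flat_def DERIV_def)
  next
    case 3
    have "((\<lambda>x. exp (- (1 / x))) has_real_derivative exp (- (1 / x)) * (1 / x ^ 2)) (at x)"
      using 3 by (auto intro!: derivative_eq_intros simp: power2_eq_square)
    moreover have "((\<lambda>x. x ^ n) has_real_derivative real n * x ^ (n - 1)) (at x)"
      by (rule DERIV_pow[THEN DERIV_cong]) simp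
    ultimately have "((\<lambda>x. exp (- (1 / x)) / x ^ n) has_real_derivative
        (exp (- (1 / x)) * (1 / x ^ 2) * x ^ n - exp (- (1 / x)) * (real n * x ^ (n - 1))) /
        (x ^ n * x ^ n)) (at x)"
      using 3 by (intro DERIV_divide) auto
    moreover have "(exp (- (1 / x)) * (1 / x ^ 2) * x ^ n - exp (- (1 / x)) * (real n * x ^ (n - 1))) /
        (x ^ n * x ^ n) = flat (n + 2) x - real n * flat (n + 1) x"
    proof (cases n)
      case 0
      thus ?thesis using 3 by (simp add: flat_def power2_eq_square)
    next
      case (Suc m)
      have "(E * (1 / x ^ 2) * x ^ Suc m - E * (r * x ^ m)) / (x ^ Suc m * x ^ Suc m) =
          E / x ^ (Suc m + 2) - r * (E / x ^ (Suc m + 1))" for E r :: real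
        using 3 by (simp add: divide_simps) (simp add: algebra_simps power2_eq_square)
      thus ?thesis using 3 Suc by (simp only: flat_def if_True diff_Suc_1)
    qed
    ultimately have "((\<lambda>x. exp (- (1 / x)) / x ^ n) has_real_derivative
            (flat (n + 2) x - real n * flat (n + 1) x)) (at x)"
      by simp
    thus ?thesis
      by (rule has_field_derivative_transform_within_open[where S="{0<..}"])
         (use 3 in \<open>auto simp: flat_def\<close>)
  qed
qed

text \<open>
  A class of functions that is closed under differentiation by its very form consists of
  infinitely differentiable functions, so smoothness of the test functions below needs no formula
  for higher derivatives. The exponential is a generator because of \<open>plateau\<close>.
\<close>

inductive flat_generated :: "(real \<Rightarrow> real) \<Rightarrow> bool" where
  const: "flat_generated (\<lambda>x. c)"
| flat: "flat_generated (\<lambda>x. flat n (c * x + d))"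
| add: "flat_generated f \<Longrightarrow> flat_generated g \<Longrightarrow> flat_generated (\<lambda>x. f x + g x)"
| mult: "flat_generated f \<Longrightarrow> flat_generated g \<Longrightarrow> flat_generated (\<lambda>x. f x * g x)"
| exp: "flat_generated f \<Longrightarrow> flat_generated (\<lambda>x. exp (f x))"

lemma flat_generated_derivative:
  assumes "flat_generated f"
  shows "\<exists>f'. flat_generated f' \<and> (\<forall>x. (f has_real_derivative f' x) (at x))"
  using assms
proof induction
  case (const c)
  show ?case by (rule exI[of _ "\<lambda>x. 0"]) (auto intro: flat_generated.const)
next
  case (flat n c d)
  have "((\<lambda>x. flat n (c * x + d)) has_real_derivative
      (c * (flat (n + 2) (c * x + d) + (- real n) * flat (n + 1) (c * x + d)))) (at x)" for x
    by (rule DERIV_chain'[THEN DERIV_cong, OF _ has_real_derivative_flat])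
       (auto intro!: derivative_eq_intros)
  moreover have "flat_generated (\<lambda>x. c * (flat (n + 2) (c * x + d) + (- real n) * flat (n + 1) (c * x + d)))"
    by (intro flat_generated.intros)
  ultimately show ?case by blast
next
  case (add f g)
  then obtain f' g' where "flat_generated f'" "\<forall>x. (f has_real_derivative f' x) (at x)"
    "flat_generated g'" "\<forall>x. (g has_real_derivative g' x) (at x)" by blast
  thus ?case
    by (intro exI[of _ "\<lambda>x. f' x + g' x"] conjI allI flat_generated.add DERIV_add) auto
next
  case (mult f g)
  then obtain f' g' where "flat_generated f'" "\<forall>x. (f has_real_derivative f' x) (at x)"
    "flat_generated g'" "\<forall>x. (g has_real_derivative g' x) (at x)" by blast
  thus ?case using mult.hyps
    by (intro exI[of _ "\<lambda>x. f' x * g x + g' x * f x"] conjI allI DERIV_mult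
          flat_generated.add flat_generated.mult) auto
next
  case (exp f)
  then obtain f' where "flat_generated f'" "\<forall>x. (f has_real_derivative f' x) (at x)" by blast
  thus ?case using exp.hyps
    by (intro exI[of _ "\<lambda>x. exp (f x) * f' x"] conjI allI DERIV_exp[THEN DERIV_chain2]
          flat_generated.exp flat_generated.mult) auto
qed

lemma flat_generated_deriv: "flat_generated f \<Longrightarrow> flat_generated (deriv f)"
  using flat_generated_derivative[of f] by (metis DERIV_imp_deriv ext)

lemma flat_generated_differentiable:
  "flat_generated f \<Longrightarrow> (deriv ^^ k) f differentiable_on UNIV"
proof (induction k arbitrary: f)
  case 0
  thus ?case
    using flat_generated_derivative[of f]
    by (auto simp: differentiable_on_eq_differentiable_at real_differentiable_def)
next
  case (Suc k)
  show ?case unfolding funpow_Suc_right comp_def by (intro Suc.IH flat_generated_deriv Suc.prems)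
qed

lemma flat_generated_continuous: "flat_generated f \<Longrightarrow> continuous_on S f"
  using flat_generated_differentiable[of f 0]
  by (auto intro: differentiable_imp_continuous_on continuous_on_subset)

text \<open>
  The test functions in the lemma of du Bois-Reymond arise by integration and are not generated by
  the rules above; they are smooth because their first derivative is generated.
\<close>

lemma antiderivative_differentiable:
  assumes "flat_generated f" "\<And>x. (F has_real_derivative f x) (at x)"
  shows "(deriv ^^ k) F differentiable_on UNIV"
proof (cases k)
  case 0
  thus ?thesis using assms(2) by (auto simp: differentiable_on_eq_differentiable_at real_differentiable_def)
next
  case (Suc m)
  have "deriv F = f" using assms(2) by (auto intro: DERIV_imp_deriv)
  thus ?thesis using Suc flat_generated_differentiable[OF assms(1)]
    by (simp add: funpow_Suc_right del: funpow.simps)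
qed

lemma test_funI:
  assumes smooth: "\<And>k. (deriv ^^ k) \<phi> differentiable_on UNIV"
    and zero: "\<And>x. x \<notin> {a..b} \<Longrightarrow> \<phi> x = 0" and ab: "-L < a" "b < L"
  shows "test_fun L \<phi>"
proof -
  have sub: "closure {x. \<phi> x \<noteq> 0} \<subseteq> {a..b}"
    using zero by (intro closure_minimal) blast+
  hence "compact (closure {x. \<phi> x \<noteq> 0})"
    using bounded_subset[OF bounded_closed_interval sub] by (simp only: compact_eq_bounded_closed closed_closure)
  thus ?thesis unfolding test_fun_def using smooth sub ab by auto
qed

text \<open>
  A smooth approximation of the indicator of \<open>{a<..<b}\<close>. The product of the two flat functions is
  positive exactly on an interval, and \<open>1 - exp (- n y)\<close> sends every \<open>y > 0\<close> to \<open>1\<close> as \<open>n\<close> grows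
  while fixing the value \<open>0\<close> at \<open>y = 0\<close>. The interval is shrunk by \<open>1 / Suc n\<close> at each end, so that the support
  stays inside the open domain even when \<open>a\<close> and \<open>b\<close> are its endpoints.
\<close>

definition plateau :: "real \<Rightarrow> real \<Rightarrow> nat \<Rightarrow> real \<Rightarrow> real" where
  "plateau a b n x =
     1 - exp (- real n * (flat 0 (x - (a + 1 / Suc n)) * flat 0 (b - 1 / Suc n - x)))"

lemma flat_nonneg: "flat n x \<ge> 0"
  by (simp add: flat_def)

lemma plateau_bounds: "0 \<le> plateau a b n x" "plateau a b n x \<le> 1"
  by (auto simp: plateau_def flat_nonneg)

lemma flat_generated_plateau: "flat_generated (plateau a b n)"
proof -
  have "flat_generated (\<lambda>x. 1 + (-1) * exp ((- real n) *
     (flat 0 (1 * x + (- (a + 1 / Suc n))) * flat 0 ((-1) * x + (b - 1 / Suc n)))))"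
    by (intro flat_generated.intros)
  moreover have "plateau a b n = (\<lambda>x. 1 + (-1) * exp ((- real n) *
     (flat 0 (1 * x + (- (a + 1 / Suc n))) * flat 0 ((-1) * x + (b - 1 / Suc n)))))"
    unfolding plateau_def by (intro ext) (simp add: algebra_simps)
  ultimately show ?thesis by simp
qed

lemma plateau_eq_0: "x \<notin> {a + 1 / Suc n..b - 1 / Suc n} \<Longrightarrow> plateau a b n x = 0"
  by (auto simp: plateau_def flat_def)

lemma test_fun_plateau:
  assumes "-L \<le> a" "b \<le> L"
  shows "test_fun L (plateau a b n)"
proof (rule test_funI)
  show "(deriv ^^ k) (plateau a b n) differentiable_on UNIV" for k
    by (rule flat_generated_differentiable[OF flat_generated_plateau])
  show "x \<notin> {a + 1 / Suc n..b - 1 / Suc n} \<Longrightarrow> plateau a b n x = 0" for x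
    by (rule plateau_eq_0)
  have "0 < 1 / real (Suc n)" by simp
  thus "-L < a + 1 / Suc n" "b - 1 / Suc n < L" using assms by linarith+
qed

lemma plateau_tendsto: "(\<lambda>n. plateau a b n x) \<longlonglongrightarrow> indicator {a<..<b} x"
proof (cases "x \<in> {a<..<b}")
  case True
  have cont: "isCont (flat 0) y" for y
    by (rule DERIV_isCont[OF has_real_derivative_flat])
  have "(\<lambda>n. flat 0 (x - (a + 1 / Suc n))) \<longlonglongrightarrow> flat 0 (x - a)"
    by (rule isCont_tendsto_compose[OF cont])
       (use tendsto_diff[OF tendsto_const tendsto_add[OF tendsto_const LIMSEQ_Suc[OF lim_1_over_n]]]
        in simp)
  moreover have "(\<lambda>n. flat 0 (b - 1 / Suc n - x)) \<longlonglongrightarrow> flat 0 (b - x)"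
    by (rule isCont_tendsto_compose[OF cont])
       (use tendsto_diff[OF tendsto_diff[OF tendsto_const LIMSEQ_Suc[OF lim_1_over_n]] tendsto_const]
        in simp)
  ultimately have lim: "(\<lambda>n. flat 0 (x - (a + 1 / Suc n)) * flat 0 (b - 1 / Suc n - x))
      \<longlonglongrightarrow> flat 0 (x - a) * flat 0 (b - x)"
    by (rule tendsto_mult)
  have pos: "flat 0 (x - a) * flat 0 (b - x) > 0"
    using True by (simp add: flat_def)
  have "filterlim (\<lambda>n. (flat 0 (x - (a + 1 / Suc n)) * flat 0 (b - 1 / Suc n - x)) * real n)
      at_top sequentially"
    by (rule filterlim_tendsto_pos_mult_at_top[OF lim pos filterlim_real_sequentially])
  hence "filterlim (\<lambda>n. - real n * (flat 0 (x - (a + 1 / Suc n)) * flat 0 (b - 1 / Suc n - x)))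
      at_bot sequentially"
    by (simp add: filterlim_uminus_at_top mult.commute)
  hence "(\<lambda>n. exp (- real n * (flat 0 (x - (a + 1 / Suc n)) * flat 0 (b - 1 / Suc n - x)))) \<longlonglongrightarrow> 0"
    by (rule filterlim_compose[OF exp_at_bot])
  from tendsto_diff[OF tendsto_const[of 1] this] show ?thesis
    using True by (simp add: plateau_def)
next
  case False
  have "x \<notin> {a + 1 / Suc n..b - 1 / Suc n}" for n
  proof -
    have "0 < 1 / real (Suc n)" by simp
    thus ?thesis using False unfolding atLeastAtMost_iff greaterThanLessThan_iff by linarith
  qed
  thus ?thesis using False by (simp add: plateau_eq_0)
qed

section \<open>Absolutely continuous functions\<close>

text \<open>
  Written as an integral over the whole domain with an indicator, so that products of primitives
  become double integrals over a fixed product space.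
\<close>

definition primitive :: "real \<Rightarrow> (real \<Rightarrow> real) \<Rightarrow> real \<Rightarrow> real" where
  "primitive L f x = (LINT s|dom_meas L. indicator {..x} s * f s)"

definition has_ac_deriv :: "real \<Rightarrow> (real \<Rightarrow> real) \<Rightarrow> (real \<Rightarrow> real) \<Rightarrow> bool" where
  "has_ac_deriv L F f \<longleftrightarrow> integrable (dom_meas L) f \<and>
     (\<forall>x\<in>{-L..L}. F x = F (-L) + primitive L f x)"

lemma finite_measure_dom_meas: "finite_measure (dom_meas L)"
  by (rule finite_measure_lebesgue_on) (simp add: lmeasurable_box)

lemma borel_measurable_dom_meas: "f \<in> borel_measurable borel \<Longrightarrow> f \<in> borel_measurable (dom_meas L)"
  for f :: "real \<Rightarrow> real"
  by (intro measurable_restrict_space1) (simp add: measurable_completion)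

lemma AE_dom_meas_neq: "AE s in dom_meas L. s \<noteq> x"
proof -
  have "AE s in lebesgue. s \<noteq> x"
    by (intro AE_completion AE_lborel_singleton)
  thus ?thesis by (subst AE_restrict_space_iff) auto
qed

lemma integrable_indicator_times:
  fixes f :: "real \<Rightarrow> real"
  assumes "integrable (dom_meas L) f" "A \<in> sets borel"
  shows "integrable (dom_meas L) (\<lambda>s. indicator A s * f s)"
proof (rule Bochner_Integration.integrable_bound[OF assms(1)])
  show "(\<lambda>s. indicator A s * f s) \<in> borel_measurable (dom_meas L)"
    using assms by (intro borel_measurable_times borel_measurable_dom_meas borel_measurable_indicator
        borel_measurable_integrable[OF assms(1)])
qed (auto simp: indicator_def)

lemma primitive_eq_integral:
  assumes f: "integrable (dom_meas L) f" and x: "x \<in> {-L..L}"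
  shows "f integrable_on {-L..L}" "primitive L f x = integral {-L..x} f"
proof -
  have "f integrable_on {-L<..<L}"
    using f by (intro integrable_on_lebesgue_on) auto
  thus "f integrable_on {-L..L}"
    by (simp add: integrable_on_open_interval_real)
  have "primitive L f x = integral {-L<..<L} (\<lambda>s. indicator {..x} s * f s)"
    unfolding primitive_def
    by (intro lebesgue_integral_eq_integral integrable_indicator_times f) auto
  also have "\<dots> = integral {-L..L} (\<lambda>s. if s \<in> {..x} then f s else 0)"
    by (subst integral_open_interval_real) (auto intro!: integral_cong simp: indicator_def)
  also have "\<dots> = integral ({..x} \<inter> {-L..L}) f"
    by (rule integral_restrict_Int)
  also have "{..x} \<inter> {-L..L} = {-L..x}" using x by auto
  finally show "primitive L f x = integral {-L..x} f" .
qed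

lemma primitive_left: "primitive L f (-L) = 0"
  unfolding primitive_def
  by (rule integral_eq_zero_AE, rule AE_I2) (auto simp: indicator_def)

lemma primitive_right: "primitive L f L = (LINT s|dom_meas L. f s)"
  unfolding primitive_def by (intro Bochner_Integration.integral_cong) (auto simp: indicator_def)

lemma continuous_on_primitive:
  assumes "integrable (dom_meas L) f"
  shows "continuous_on {-L..L} (primitive L f)"
proof (cases "L < 0")
  case False
  hence "f integrable_on {-L..L}" by (intro primitive_eq_integral(1)[OF assms, of L]) simp
  hence "continuous_on {-L..L} (\<lambda>x. integral {-L..x} f)" by (rule indefinite_integral_continuous_1)
  thus ?thesis using primitive_eq_integral(2)[OF assms] by (simp cong: continuous_on_cong_simp)
qed simp

lemma has_ac_deriv_integrable: "has_ac_deriv L F f \<Longrightarrow> integrable (dom_meas L) f"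
  by (simp add: has_ac_deriv_def)

lemma has_ac_deriv_eq:
  "has_ac_deriv L F f \<Longrightarrow> x \<in> {-L..L} \<Longrightarrow> F x = F (-L) + primitive L f x"
  unfolding has_ac_deriv_def by blast

lemma has_ac_deriv_continuous:
  assumes "has_ac_deriv L F f"
  shows "continuous_on {-L..L} F"
proof -
  have "continuous_on {-L..L} (\<lambda>x. F (-L) + primitive L f x)"
    by (intro continuous_intros continuous_on_primitive has_ac_deriv_integrable[OF assms])
  moreover have "continuous_on {-L..L} F \<longleftrightarrow> continuous_on {-L..L} (\<lambda>x. F (-L) + primitive L f x)"
    by (intro continuous_on_cong refl has_ac_deriv_eq[OF assms])
  ultimately show ?thesis by simp
qed

lemma has_ac_deriv_integral:
  assumes "has_ac_deriv L F f" "L > 0"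
  shows "(LINT x|dom_meas L. f x) = F L - F (-L)"
  using has_ac_deriv_eq[OF assms(1), of L] assms(2) by (simp add: primitive_right)

lemma continuous_on_measurable_dom:
  fixes F :: "real \<Rightarrow> real"
  assumes "continuous_on {-L..L} F"
  shows "F \<in> borel_measurable (dom_meas L)"
  by (intro continuous_imp_measurable_on_sets_lebesgue continuous_on_subset[OF assms]) auto

lemma continuous_on_bounded_dom:
  fixes F :: "real \<Rightarrow> real"
  assumes "continuous_on {-L..L} F"
  obtains B where "\<And>x. x \<in> {-L..L} \<Longrightarrow> \<bar>F x\<bar> \<le> B"
proof -
  have "bounded (F ` {-L..L})"
    by (intro compact_imp_bounded compact_continuous_image assms) simp
  thus ?thesis using that unfolding bounded_iff by (metis imageI real_norm_def)
qed

lemma integrable_continuous_times: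
  fixes F f :: "real \<Rightarrow> real"
  assumes F: "continuous_on {-L..L} F" and f: "integrable (dom_meas L) f"
  shows "integrable (dom_meas L) (\<lambda>x. F x * f x)"
proof -
  obtain B where B: "\<And>x. x \<in> {-L..L} \<Longrightarrow> \<bar>F x\<bar> \<le> B"
    using continuous_on_bounded_dom[OF F] by blast
  show ?thesis
  proof (rule Bochner_Integration.integrable_bound)
    show "integrable (dom_meas L) (\<lambda>x. B * f x)" using f by simp
    show "(\<lambda>x. F x * f x) \<in> borel_measurable (dom_meas L)"
      by (intro borel_measurable_times continuous_on_measurable_dom F borel_measurable_integrable[OF f])
    show "AE x in dom_meas L. norm (F x * f x) \<le> norm (B * f x)"
    proof (rule AE_I2)
      fix x assume "x \<in> space (dom_meas L)"
      hence "\<bar>F x\<bar> \<le> \<bar>B\<bar>" using B[of x] by auto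
      thus "norm (F x * f x) \<le> norm (B * f x)" by (simp add: abs_mult mult_right_mono)
    qed
  qed
qed

lemma primitive_add:
  assumes "integrable (dom_meas L) f" "integrable (dom_meas L) g"
  shows "primitive L (\<lambda>s. f s + g s) x = primitive L f x + primitive L g x"
  unfolding primitive_def using assms by (simp add: distrib_left integrable_indicator_times)

text \<open>
  The product is the integral of \<open>f s * g t\<close> over the square \<open>s \<le> x, t \<le> x\<close>. Cutting the square
  along its diagonal and integrating each triangle first in the smaller variable gives the two
  summands.
\<close>

lemma primitive_mult:
  assumes f: "integrable (dom_meas L) f" and g: "integrable (dom_meas L) g"
  shows "primitive L f x * primitive L g x =
    primitive L (\<lambda>s. primitive L g s * f s + primitive L f s * g s) x"
proof -
  let ?M = "dom_meas L"
  let ?R = "\<lambda>Q s t. if Q s t then f s * g t else 0"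
  interpret finite_measure ?M by (rule finite_measure_dom_meas)
  interpret P: pair_sigma_finite ?M ?M ..
  have [measurable]: "f \<in> borel_measurable ?M" "g \<in> borel_measurable ?M" using f g by auto
  have [measurable]: "(\<lambda>s. s) \<in> borel_measurable ?M" by (rule borel_measurable_dom_meas) simp
  have fg: "integrable (?M \<Otimes>\<^sub>M ?M) (\<lambda>(s, t). f s * g t)"
  proof (rule P.Fubini_integrable)
    show "integrable ?M (\<lambda>s. LINT t|?M. norm (case (s, t) of (s, t) \<Rightarrow> f s * g t))"
      using f by (simp add: abs_mult)
    show "AE s in ?M. integrable ?M (\<lambda>t. case (s, t) of (s, t) \<Rightarrow> f s * g t)"
      using g by simp
  qed measurable
  have int: "integrable (?M \<Otimes>\<^sub>M ?M) (\<lambda>(s, t). ?R Q s t)"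
    if [measurable]: "Measurable.pred (?M \<Otimes>\<^sub>M ?M) (\<lambda>(s, t). Q s t)" for Q
  proof (rule Bochner_Integration.integrable_bound[OF fg])
    show "(\<lambda>(s, t). ?R Q s t) \<in> borel_measurable (?M \<Otimes>\<^sub>M ?M)"
      unfolding split_beta' using that by (intro measurable_If) (simp_all add: split_beta')
  qed auto
  have fst: "(LINT z|(?M \<Otimes>\<^sub>M ?M). (case z of (s, t) \<Rightarrow> ?R Q s t)) = (LINT s|?M. LINT t|?M. ?R Q s t)"
    if "Measurable.pred (?M \<Otimes>\<^sub>M ?M) (\<lambda>(s, t). Q s t)" for Q
    using P.integral_fst'[OF int[OF that]] by simp
  have snd: "(LINT z|(?M \<Otimes>\<^sub>M ?M). (case z of (s, t) \<Rightarrow> ?R Q s t)) = (LINT t|?M. LINT s|?M. ?R Q s t)"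
    if "Measurable.pred (?M \<Otimes>\<^sub>M ?M) (\<lambda>(s, t). Q s t)" for Q
    using P.integral_snd[OF int[OF that]] by simp
  have m1: "Measurable.pred (?M \<Otimes>\<^sub>M ?M) (\<lambda>(s, t). s \<le> x \<and> t \<le> x)" by measurable
  have m2: "Measurable.pred (?M \<Otimes>\<^sub>M ?M) (\<lambda>(s, t). s \<le> t \<and> t \<le> x)" by measurable
  have m3: "Measurable.pred (?M \<Otimes>\<^sub>M ?M) (\<lambda>(s, t). t < s \<and> s \<le> x)" by measurable
  have inner1: "(LINT t|?M. ?R (\<lambda>s t. s \<le> x \<and> t \<le> x) s t) = (indicator {..x} s * f s) * primitive L g x" for s
  proof -
    have "(\<lambda>t. ?R (\<lambda>s t. s \<le> x \<and> t \<le> x) s t) = (\<lambda>t. (indicator {..x} s * f s) * (indicator {..x} t * g t))"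
      by (auto simp: indicator_def)
    thus ?thesis unfolding primitive_def by (simp only: integral_mult_right_zero)
  qed
  have inner2: "(LINT s|?M. ?R (\<lambda>s t. s \<le> t \<and> t \<le> x) s t) = indicator {..x} t * (primitive L f t * g t)" for t
  proof -
    have "(\<lambda>s. ?R (\<lambda>s t. s \<le> t \<and> t \<le> x) s t) = (\<lambda>s. (indicator {..x} t * g t) * (indicator {..t} s * f s))"
      by (auto simp: indicator_def)
    thus ?thesis unfolding primitive_def by (simp only: integral_mult_right_zero) (simp only: mult_ac)
  qed
  have inner3: "(LINT t|?M. ?R (\<lambda>s t. t < s \<and> s \<le> x) s t) = indicator {..x} s * (primitive L g s * f s)" for s
  proof -
    \<comment> \<open>The triangle omits its diagonal, which is a null set.\<close>
    have "AE t in ?M. ?R (\<lambda>s t. t < s \<and> s \<le> x) s t = (indicator {..x} s * f s) * (indicator {..s} t * g t)"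
      using AE_dom_meas_neq[of s L] by eventually_elim (auto simp: indicator_def)
    hence "(LINT t|?M. ?R (\<lambda>s t. t < s \<and> s \<le> x) s t) =
        (LINT t|?M. (indicator {..x} s * f s) * (indicator {..s} t * g t))"
      by (intro integral_cong_AE) measurable
    thus ?thesis unfolding primitive_def by (simp only: integral_mult_right_zero) (simp only: mult_ac)
  qed
  have "primitive L f x * primitive L g x = (LINT s|?M. (indicator {..x} s * f s) * primitive L g x)"
    by (simp only: integral_mult_left_zero primitive_def)
  also have "\<dots> = (LINT z|(?M \<Otimes>\<^sub>M ?M). (case z of (s, t) \<Rightarrow> ?R (\<lambda>s t. s \<le> x \<and> t \<le> x) s t))"
    by (simp only: fst[OF m1] inner1)
  also have "\<dots> = (LINT z|(?M \<Otimes>\<^sub>M ?M).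
      (case z of (s, t) \<Rightarrow> ?R (\<lambda>s t. s \<le> t \<and> t \<le> x) s t) + (case z of (s, t) \<Rightarrow> ?R (\<lambda>s t. t < s \<and> s \<le> x) s t))"
    by (intro Bochner_Integration.integral_cong refl) auto
  also have "\<dots> = (LINT z|(?M \<Otimes>\<^sub>M ?M). (case z of (s, t) \<Rightarrow> ?R (\<lambda>s t. s \<le> t \<and> t \<le> x) s t)) +
      (LINT z|(?M \<Otimes>\<^sub>M ?M). (case z of (s, t) \<Rightarrow> ?R (\<lambda>s t. t < s \<and> s \<le> x) s t))"
    by (rule Bochner_Integration.integral_add[OF int[OF m2] int[OF m3]])
  also have "\<dots> = primitive L (\<lambda>s. primitive L f s * g s) x + primitive L (\<lambda>s. primitive L g s * f s) x"
    by (simp only: snd[OF m2] fst[OF m3] inner2 inner3 primitive_def[of L _ x])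
  also have "\<dots> = primitive L (\<lambda>s. primitive L g s * f s + primitive L f s * g s) x"
    using f g by (simp add: primitive_add integrable_continuous_times continuous_on_primitive)
  finally show ?thesis .
qed

lemma primitive_cmult: "primitive L (\<lambda>s. c * f s) x = c * primitive L f x"
  unfolding primitive_def by (simp add: mult.left_commute)

lemma primitive_cong:
  "(\<And>s. s \<in> {-L<..<L} \<Longrightarrow> f s = g s) \<Longrightarrow> primitive L f x = primitive L g x"
  unfolding primitive_def by (intro Bochner_Integration.integral_cong) auto

text \<open>
  The product rule for absolutely continuous functions: expand both factors as a boundary value
  plus a primitive; only the product of the two primitives is not linear.
\<close>

lemma has_ac_deriv_mult:
  assumes F: "has_ac_deriv L F f" and G: "has_ac_deriv L G g"
  shows "has_ac_deriv L (\<lambda>x. F x * G x) (\<lambda>x. G x * f x + F x * g x)"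
  unfolding has_ac_deriv_def
proof (intro conjI ballI)
  have f: "integrable (dom_meas L) f" and g: "integrable (dom_meas L) g"
    using F G by (auto dest: has_ac_deriv_integrable)
  show "integrable (dom_meas L) (\<lambda>x. G x * f x + F x * g x)"
    by (intro Bochner_Integration.integrable_add integrable_continuous_times f g
        has_ac_deriv_continuous[OF F] has_ac_deriv_continuous[OF G])
  fix x assume x: "x \<in> {-L..L}"
  let ?f = "\<lambda>s. primitive L f s" and ?g = "\<lambda>s. primitive L g s"
  have "primitive L (\<lambda>x. G x * f x + F x * g x) x =
     primitive L (\<lambda>s. (?g s * f s + ?f s * g s) + (G (-L) * f s + F (-L) * g s)) x"
  proof (rule primitive_cong)
    fix s assume "s \<in> {-L<..<L}"
    hence s: "s \<in> {-L..L}" by simp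
    show "G s * f s + F s * g s = (?g s * f s + ?f s * g s) + (G (-L) * f s + F (-L) * g s)"
      unfolding has_ac_deriv_eq[OF F s] has_ac_deriv_eq[OF G s] by (simp add: algebra_simps)
  qed
  also have "\<dots> = primitive L (\<lambda>s. ?g s * f s + ?f s * g s) x + (G (-L) * ?f x + F (-L) * ?g x)"
    by (simp add: primitive_add primitive_cmult f g integrable_continuous_times continuous_on_primitive)
  also have "primitive L (\<lambda>s. ?g s * f s + ?f s * g s) x = ?f x * ?g x"
    by (rule primitive_mult[OF f g, symmetric])
  finally have "primitive L (\<lambda>x. G x * f x + F x * g x) x =
      ?f x * ?g x + (G (-L) * ?f x + F (-L) * ?g x)" .
  moreover have "F x * G x = (F (-L) + ?f x) * (G (-L) + ?g x)"
    using has_ac_deriv_eq[OF F x] has_ac_deriv_eq[OF G x] by simp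
  ultimately show "F x * G x = F (-L) * G (-L) + primitive L (\<lambda>x. G x * f x + F x * g x) x"
    by (simp add: algebra_simps)
qed

lemma C1_has_ac_deriv:
  assumes F: "\<And>x. (F has_real_derivative f x) (at x)" and cont: "continuous_on UNIV f"
  shows "has_ac_deriv L F f"
  unfolding has_ac_deriv_def
proof (intro conjI ballI)
  interpret finite_measure "dom_meas L" by (rule finite_measure_dom_meas)
  have "integrable (dom_meas L) (\<lambda>x. f x * 1)"
    by (intro integrable_continuous_times continuous_on_subset[OF cont]) auto
  thus f: "integrable (dom_meas L) f" by simp
  fix x assume x: "x \<in> {-L..L}"
  have "(f has_integral F x - F (-L)) {-L..x}"
    using x F by (intro fundamental_theorem_of_calculus)
      (auto simp: has_real_derivative_iff_has_vector_derivative[symmetric] intro: has_field_derivative_at_within)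
  thus "F x = F (-L) + primitive L f x"
    using primitive_eq_integral(2)[OF f x] by (simp add: integral_unique)
qed

section \<open>The fundamental lemma and the lemma of du Bois-Reymond\<close>

text \<open>
  The plateau functions approximate the indicator of an interval boundedly and pointwise, so the
  integrals of \<open>k\<close> over intervals vanish. Only members of \<open>flat_generated\<close> are tested
  against, so that \<open>test_fun_antiderivative\<close> can supply the hypothesis.
\<close>

lemma AE_zero_if_test_integrals_zero:
  assumes k: "integrable (dom_meas L) k"
    and zero: "\<And>\<phi>. test_fun L \<phi> \<Longrightarrow> flat_generated \<phi> \<Longrightarrow> (LINT x|dom_meas L. k x * \<phi> x) = 0"
  shows "AE x in dom_meas L. k x = 0"
proof -
  let ?k = "\<lambda>x. indicator {-L<..<L} x * k x"
  have inside: "(LINT x|dom_meas L. indicator {a<..<b} x * k x) = 0" if "-L \<le> a" "b \<le> L" for a b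
  proof -
    have "(\<lambda>n. LINT x|dom_meas L. k x * plateau a b n x)
        \<longlonglongrightarrow> (LINT x|dom_meas L. k x * indicator {a<..<b} x)"
    proof (rule integral_dominated_convergence[where w="\<lambda>x. \<bar>k x\<bar>"])
      show "AE x in dom_meas L. (\<lambda>n. k x * plateau a b n x) \<longlonglongrightarrow> k x * indicator {a<..<b} x"
        by (intro AE_I2 tendsto_mult tendsto_const plateau_tendsto)
      show "AE x in dom_meas L. norm (k x * plateau a b n x) \<le> \<bar>k x\<bar>" for n
        using plateau_bounds[of a b n]
        by (intro AE_I2) (simp add: abs_mult mult_left_le)
      show "(\<lambda>x. k x * indicator {a<..<b} x) \<in> borel_measurable (dom_meas L)"
        by (intro borel_measurable_times borel_measurable_integrable[OF k]
            borel_measurable_dom_meas borel_measurable_indicator) simp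
      show "(\<lambda>x. k x * plateau a b n x) \<in> borel_measurable (dom_meas L)" for n
        by (intro borel_measurable_times borel_measurable_integrable[OF k]
            continuous_on_measurable_dom flat_generated_continuous flat_generated_plateau)
    qed (use k in simp)
    moreover have "(LINT x|dom_meas L. k x * plateau a b n x) = 0" for n
      by (intro zero test_fun_plateau flat_generated_plateau that)
    ultimately show ?thesis by (simp add: LIMSEQ_const_iff mult.commute)
  qed
  have "AE x in lebesgue. ?k x = 0"
  proof (rule AE_zero_if_interval_integrals_zero)
    show "integrable lebesgue ?k"
      using k by (simp add: integrable_restrict_space)
    fix a b :: real
    have "(LINT x|lebesgue. indicator {a<..<b} x * ?k x) =
        (LINT x|dom_meas L. indicator {max a (-L)<..<min b L} x * k x)"
      by (subst integral_restrict_space)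
         (auto intro!: Bochner_Integration.integral_cong simp: indicator_def)
    also have "\<dots> = 0" by (rule inside) auto
    finally show "(LINT x|lebesgue. indicator {a<..<b} x * ?k x) = 0" .
  qed
  hence "AE x in lebesgue. x \<in> {-L<..<L} \<longrightarrow> k x = 0"
    by eventually_elim (auto simp: indicator_def)
  thus ?thesis by (subst AE_restrict_space_iff) auto
qed

lemma antiderivative_exists:
  fixes f :: "real \<Rightarrow> real"
  assumes "continuous_on UNIV f"
  shows "\<exists>F. \<forall>x. (F has_real_derivative f x) (at x)"
proof (intro exI allI)
  fix x :: real
  \<comment> \<open>The integral from \<open>0\<close> is one function on the whole line; the interval only needs to contain \<open>0\<close> and \<open>x\<close>.\<close>
  let ?a = "- \<bar>x\<bar> - 1" and ?b = "\<bar>x\<bar> + 1"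
  have "((\<lambda>u. LBINT y=0..u. f y) has_vector_derivative f x) (at x within {?a..?b})"
    using interval_integral_FTC2[of ?a 0 ?b f x] continuous_on_subset[OF assms]
    by (simp add: zero_ereal_def)
  thus "((\<lambda>u. LBINT y=0..u. f y) has_real_derivative f x) (at x)"
    by (subst (asm) at_within_interior) (auto simp: has_real_derivative_iff_has_vector_derivative)
qed

lemma test_fun_support:
  assumes "test_fun L \<phi>" "L > 0"
  shows "\<exists>a b. -L < a \<and> a \<le> b \<and> b < L \<and> (\<forall>x. x \<notin> {a..b} \<longrightarrow> \<phi> x = 0)"
proof (cases "{x. \<phi> x \<noteq> 0} = {}")
  case True
  thus ?thesis using assms(2) by (intro exI[of _ 0]) auto
next
  case False
  let ?K = "closure {x. \<phi> x \<noteq> 0}"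
  have K: "compact ?K" "?K \<subseteq> {-L<..<L}" "?K \<noteq> {}"
    using assms(1) False by (auto simp: test_fun_def)
  obtain a where a: "a \<in> ?K" "\<And>x. x \<in> ?K \<Longrightarrow> a \<le> x"
    using compact_attains_inf[OF K(1,3)] by blast
  obtain b where b: "b \<in> ?K" "\<And>x. x \<in> ?K \<Longrightarrow> x \<le> b"
    using compact_attains_sup[OF K(1,3)] by blast
  show ?thesis
  proof (rule exI[of _ a], rule exI[of _ b], intro conjI allI impI)
    show "-L < a" "b < L" "a \<le> b" using a b K(2) by auto
    fix x assume "x \<notin> {a..b}"
    hence "x \<notin> ?K" using a b by auto
    thus "\<phi> x = 0" using closure_subset[of "{x. \<phi> x \<noteq> 0}"] by auto
  qed
qed

text \<open>
  The antiderivative that vanishes at \<open>-L\<close> is constant on either side of the support of \<open>\<psi>\<close>; on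
  the right the constant is the total integral of \<open>\<psi>\<close>.
\<close>

lemma test_fun_antiderivative:
  assumes L: "L > 0" and test: "test_fun L \<psi>" and gen: "flat_generated \<psi>"
    and zero: "(LINT x|dom_meas L. \<psi> x) = 0"
  shows "\<exists>\<phi>. test_fun L \<phi> \<and> deriv \<phi> = \<psi>"
proof -
  obtain a b where ab: "-L < a" "a \<le> b" "b < L" and supp: "\<forall>x. x \<notin> {a..b} \<longrightarrow> \<psi> x = 0"
    using test_fun_support[OF test L] by blast
  obtain F where F: "\<And>x. (F has_real_derivative \<psi> x) (at x)"
    using antiderivative_exists[OF flat_generated_continuous[OF gen]] by blast
  define \<phi> where "\<phi> = (\<lambda>x. F x - F (-L))"
  have \<phi>: "(\<phi> has_real_derivative \<psi> x) (at x)" for x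
    unfolding \<phi>_def by (rule derivative_eq_intros F refl | simp)+
  have "has_ac_deriv L \<phi> \<psi>"
    by (intro C1_has_ac_deriv \<phi> flat_generated_continuous gen)
  hence ends: "\<phi> (-L) = 0" "\<phi> L = 0"
    using has_ac_deriv_integral[of L \<phi> \<psi>] L zero by (auto simp: \<phi>_def)
  have left: "\<phi> x = 0" if "x < a" for x
  proof -
    have "\<exists>c. \<forall>x\<in>{..<a}. \<phi> x = c"
    proof (rule has_field_derivative_zero_constant)
      fix y assume "y \<in> {..<a}"
      thus "(\<phi> has_field_derivative 0) (at y within {..<a})"
        using \<phi>[of y] supp by (simp add: has_field_derivative_at_within)
    qed simp
    then obtain c where c: "\<And>y. y < a \<Longrightarrow> \<phi> y = c" by auto
    show ?thesis using c[OF that] c[OF ab(1)] ends by simp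
  qed
  have right: "\<phi> x = 0" if "b < x" for x
  proof -
    have "\<exists>c. \<forall>x\<in>{b<..}. \<phi> x = c"
    proof (rule has_field_derivative_zero_constant)
      fix y assume "y \<in> {b<..}"
      thus "(\<phi> has_field_derivative 0) (at y within {b<..})"
        using \<phi>[of y] supp by (simp add: has_field_derivative_at_within)
    qed simp
    then obtain c where c: "\<And>y. b < y \<Longrightarrow> \<phi> y = c" by auto
    show ?thesis using c[OF that] c[OF ab(3)] ends by simp
  qed
  have "test_fun L \<phi>"
  proof (rule test_funI)
    show "(deriv ^^ k) \<phi> differentiable_on UNIV" for k
      using gen \<phi> by (rule antiderivative_differentiable)
    show "-L < a" "b < L" by fact+
    fix x assume "x \<notin> {a..b}"
    thus "\<phi> x = 0"
      using left right by (auto simp: not_le)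
  qed
  moreover have "deriv \<phi> = \<psi>" using \<phi> by (auto intro: DERIV_imp_deriv)
  ultimately show ?thesis by blast
qed

lemma test_fun_lincomb:
  assumes L: "L > 0" and "test_fun L f" "flat_generated f" "test_fun L g" "flat_generated g"
  shows "test_fun L (\<lambda>x. f x + c * g x)" "flat_generated (\<lambda>x. f x + c * g x)"
proof -
  show gen: "flat_generated (\<lambda>x. f x + c * g x)"
    by (intro flat_generated.add flat_generated.mult flat_generated.const assms)
  obtain a b where ab: "-L < a" "a \<le> b" "b < L" "\<forall>x. x \<notin> {a..b} \<longrightarrow> f x = 0"
    using test_fun_support[OF assms(2) L] by blast
  obtain a' b' where ab': "-L < a'" "a' \<le> b'" "b' < L" "\<forall>x. x \<notin> {a'..b'} \<longrightarrow> g x = 0"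
    using test_fun_support[OF assms(4) L] by blast
  show "test_fun L (\<lambda>x. f x + c * g x)"
  proof (rule test_funI)
    show "(deriv ^^ k) (\<lambda>x. f x + c * g x) differentiable_on UNIV" for k
      by (rule flat_generated_differentiable[OF gen])
    show "-L < min a a'" "max b b' < L" using ab ab' by auto
    show "f x + c * g x = 0" if "x \<notin> {min a a'..max b b'}" for x
    proof -
      have "x \<notin> {a..b}" "x \<notin> {a'..b'}" using that by auto
      thus ?thesis using ab(4) ab'(4) by simp
    qed
  qed
qed

lemma integrable_times_flat_generated:
  assumes "integrable (dom_meas L) h" "flat_generated \<phi>"
  shows "integrable (dom_meas L) (\<lambda>x. h x * \<phi> x)"
  using integrable_continuous_times[OF flat_generated_continuous[OF assms(2)] assms(1)]
  by (simp add: mult.commute)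

text \<open>
  The lemma of du Bois-Reymond. With \<open>\<psi>0\<close> a fixed test function of nonzero mass, any test
  function \<open>\<psi>\<close> becomes the derivative of a test function after subtraction of a multiple of
  \<open>\<psi>0\<close>. Orthogonality to derivatives then says that \<open>h - c\<close> is orthogonal to all \<open>\<psi>\<close>, where \<open>c\<close>
  is the mean of \<open>h\<close> weighted by \<open>\<psi>0\<close>.
\<close>

lemma AE_const_if_test_deriv_integrals_zero:
  assumes L: "L > 0" and h: "integrable (dom_meas L) h"
    and zero: "\<And>\<phi>. test_fun L \<phi> \<Longrightarrow> (LINT x|dom_meas L. h x * deriv \<phi> x) = 0"
  shows "\<exists>c. AE x in dom_meas L. h x = c"
proof -
  interpret finite_measure "dom_meas L" by (rule finite_measure_dom_meas)
  have one: "integrable (dom_meas L) (\<lambda>x. 1 :: real)" by simp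
  have "\<not> (AE x in dom_meas L. (1::real) = 0)"
  proof
    assume "AE x in dom_meas L. (1::real) = 0"
    hence "AE x in lebesgue. x \<in> {-L<..<L} \<longrightarrow> x \<in> {}" 
      by (subst (asm) AE_restrict_space_iff) auto
    from mem_closed_if_AE_lebesgue_open[OF _ _ this, of 0] L show False by simp
  qed
  \<comment> \<open>Otherwise the constant \<open>1\<close> would vanish almost everywhere, by the fundamental lemma.\<close>
  then obtain \<psi>0 where \<psi>0: "test_fun L \<psi>0" "flat_generated \<psi>0" "(LINT x|dom_meas L. \<psi>0 x) \<noteq> 0"
    using AE_zero_if_test_integrals_zero[OF one] by auto
  define c where "c = (LINT x|dom_meas L. h x * \<psi>0 x) / (LINT x|dom_meas L. \<psi>0 x)"
  have "AE x in dom_meas L. h x - c = 0"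
  proof (rule AE_zero_if_test_integrals_zero)
    show "integrable (dom_meas L) (\<lambda>x. h x - c)" using h by simp
    fix \<psi> assume \<psi>: "test_fun L \<psi>" "flat_generated \<psi>"
    define r where "r = (LINT x|dom_meas L. \<psi> x) / (LINT x|dom_meas L. \<psi>0 x)"
    define \<eta> where "\<eta> = (\<lambda>x. \<psi> x + (- r) * \<psi>0 x)"
    have \<eta>: "test_fun L \<eta>" "flat_generated \<eta>"
      unfolding \<eta>_def by (rule test_fun_lincomb[OF L \<psi> \<psi>0(1,2)])+
    note int = integrable_times_flat_generated[OF h] integrable_times_flat_generated[OF one, simplified]
    have "(LINT x|dom_meas L. \<eta> x) = 0"
      unfolding \<eta>_def using \<psi>(2) \<psi>0(2,3) by (simp add: int r_def)
    from test_fun_antiderivative[OF L \<eta> this]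
    obtain \<phi> where "test_fun L \<phi>" "deriv \<phi> = \<eta>" by blast
    hence "(LINT x|dom_meas L. h x * \<eta> x) = 0" using zero[of \<phi>] by simp
    also have "(LINT x|dom_meas L. h x * \<eta> x) = (LINT x|dom_meas L. h x * \<psi> x - r * (h x * \<psi>0 x))"
      by (simp add: \<eta>_def algebra_simps)
    also have "\<dots> = (LINT x|dom_meas L. h x * \<psi> x) - r * (LINT x|dom_meas L. h x * \<psi>0 x)"
      using int(1)[OF \<psi>(2)] int(1)[OF \<psi>0(2)] by simp
    finally show "(LINT x|dom_meas L. (h x - c) * \<psi> x) = 0"
      using int(1)[OF \<psi>(2)] int(2)[OF \<psi>(2)] by (simp add: left_diff_distrib c_def r_def)
  qed
  thus ?thesis by auto
qed

section \<open>Weak derivatives and absolutely continuous representatives\<close>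

lemma L2_measurable: "f \<in> L2 L \<Longrightarrow> f \<in> borel_measurable (dom_meas L)"
  by (simp add: L2_def)

lemma L2_square_integrable: "f \<in> L2 L \<Longrightarrow> integrable (dom_meas L) (\<lambda>x. (f x)\<^sup>2)"
  by (simp add: L2_def)

lemma L2_mult_integrable:
  assumes "f \<in> L2 L" "g \<in> L2 L"
  shows "integrable (dom_meas L) (\<lambda>x. f x * g x)"
proof (rule Bochner_Integration.integrable_bound)
  show "integrable (dom_meas L) (\<lambda>x. (f x)\<^sup>2 + (g x)\<^sup>2)"
    using assms by (simp add: L2_square_integrable)
  show "(\<lambda>x. f x * g x) \<in> borel_measurable (dom_meas L)"
    using assms by (intro borel_measurable_times L2_measurable)
  show "AE x in dom_meas L. norm (f x * g x) \<le> norm ((f x)\<^sup>2 + (g x)\<^sup>2)"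
  proof (rule AE_I2)
    fix x
    have "2 * (\<bar>f x\<bar> * \<bar>g x\<bar>) \<le> \<bar>f x\<bar>\<^sup>2 + \<bar>g x\<bar>\<^sup>2"
      using sum_squares_bound[of "\<bar>f x\<bar>" "\<bar>g x\<bar>"] by simp
    moreover have "0 \<le> \<bar>f x\<bar> * \<bar>g x\<bar>" by simp
    ultimately have "\<bar>f x\<bar> * \<bar>g x\<bar> \<le> (f x)\<^sup>2 + (g x)\<^sup>2"
      unfolding power2_abs by linarith
    thus "norm (f x * g x) \<le> norm ((f x)\<^sup>2 + (g x)\<^sup>2)"
      by (simp add: abs_mult)
  qed
qed

lemma continuous_in_L2:
  assumes "continuous_on {-L..L} F"
  shows "F \<in> L2 L"
proof -
  interpret finite_measure "dom_meas L" by (rule finite_measure_dom_meas)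
  have "integrable (dom_meas L) (\<lambda>x. (F x)\<^sup>2 * 1)"
    by (intro integrable_continuous_times continuous_intros assms) simp
  thus ?thesis using assms by (simp add: L2_def continuous_on_measurable_dom)
qed

lemma L2_integrable: 
  assumes "f \<in> L2 L"
  shows "integrable (dom_meas L) f"
  using L2_mult_integrable[OF assms continuous_in_L2[of L "\<lambda>_. 1"]] by simp

lemma L2_lincomb:
  assumes "f \<in> L2 L" "g \<in> L2 L"
  shows "(\<lambda>x. a * f x + b * g x) \<in> L2 L"
  unfolding L2_def
proof (intro CollectI conjI)
  show "(\<lambda>x. a * f x + b * g x) \<in> borel_measurable (dom_meas L)"
    by (intro borel_measurable_add borel_measurable_times L2_measurable assms measurable_const) auto
  have "integrable (dom_meas L) (\<lambda>x. a\<^sup>2 * (f x)\<^sup>2 + b\<^sup>2 * (g x)\<^sup>2 + 2 * a * b * (f x * g x))"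
    using assms by (simp add: L2_square_integrable L2_mult_integrable)
  thus "integrable (dom_meas L) (\<lambda>x. (a * f x + b * g x)\<^sup>2)"
    by (simp add: power2_eq_square algebra_simps)
qed

lemma continuous_times_L2:
  assumes F: "continuous_on {-L..L} F" and f: "f \<in> L2 L"
  shows "(\<lambda>x. F x * f x) \<in> L2 L"
  unfolding L2_def
proof (intro CollectI conjI)
  show "(\<lambda>x. F x * f x) \<in> borel_measurable (dom_meas L)"
    using f by (intro borel_measurable_times L2_measurable continuous_on_measurable_dom F)
  have "integrable (dom_meas L) (\<lambda>x. (F x)\<^sup>2 * (f x)\<^sup>2)"
    by (intro integrable_continuous_times continuous_intros F L2_square_integrable f)
  thus "integrable (dom_meas L) (\<lambda>x. (F x * f x)\<^sup>2)" by (simp add: power_mult_distrib)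
qed

lemma bracket_cong_AE:
  assumes "f \<in> borel_measurable (dom_meas L)" "f' \<in> borel_measurable (dom_meas L)"
    "g \<in> borel_measurable (dom_meas L)" "g' \<in> borel_measurable (dom_meas L)"
    "AE x in dom_meas L. f x = f' x" "AE x in dom_meas L. g x = g' x"
  shows "bracket L f g = bracket L f' g'"
  unfolding bracket_def
proof (rule integral_cong_AE)
  show "AE x in dom_meas L. f x * g x = f' x * g' x"
    using assms(5,6) by eventually_elim simp
qed (use assms in \<open>auto intro: borel_measurable_times\<close>)

lemma test_fun_has_real_derivative:
  assumes "test_fun L \<phi>"
  shows "(\<phi> has_real_derivative deriv \<phi> x) (at x)"
proof -
  have "(deriv ^^ 0) \<phi> differentiable_on UNIV" using assms unfolding test_fun_def by blast
  thus ?thesis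
    by (auto simp: differentiable_on_eq_differentiable_at real_differentiable_def DERIV_deriv_iff_real_differentiable)
qed

lemma test_fun_deriv_continuous:
  assumes "test_fun L \<phi>"
  shows "continuous_on A (deriv \<phi>)"
proof -
  have "(deriv ^^ 1) \<phi> differentiable_on UNIV" using assms unfolding test_fun_def by blast
  thus ?thesis by (auto intro: differentiable_imp_continuous_on continuous_on_subset)
qed

lemma test_fun_ac:
  assumes "test_fun L \<phi>"
  shows "has_ac_deriv L \<phi> (deriv \<phi>)"
  by (intro C1_has_ac_deriv test_fun_has_real_derivative[OF assms] test_fun_deriv_continuous[OF assms])

lemma test_fun_ends:
  assumes "test_fun L \<phi>" 
  shows "\<phi> L = 0" "\<phi> (-L) = 0"
  using assms closure_subset[of "{x. \<phi> x \<noteq> 0}"] unfolding test_fun_def by force+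

text \<open>
  This is the product rule integrated over the domain: a test function kills the boundary terms.
\<close>

lemma ac_integration_by_parts_test:
  assumes L: "L > 0" and F: "has_ac_deriv L F f" and \<phi>: "test_fun L \<phi>"
  shows "bracket L F (deriv \<phi>) = - bracket L f \<phi>"
proof -
  note ac = test_fun_ac[OF \<phi>]
  have "(LINT x|dom_meas L. \<phi> x * f x + F x * deriv \<phi> x) = 0"
    using has_ac_deriv_integral[OF has_ac_deriv_mult[OF F ac] L] test_fun_ends[OF \<phi>] by simp
  moreover have "integrable (dom_meas L) (\<lambda>x. \<phi> x * f x)" "integrable (dom_meas L) (\<lambda>x. F x * deriv \<phi> x)"
    by (intro integrable_continuous_times has_ac_deriv_integrable[OF F] has_ac_deriv_integrable[OF ac]
        has_ac_deriv_continuous[OF F] has_ac_deriv_continuous[OF ac])+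
  ultimately show ?thesis by (simp add: bracket_def mult.commute)
qed

text \<open>
  The primitive of \<open>g\<close> satisfies the same identity against test functions as \<open>f\<close>, so the difference
  is orthogonal to all derivatives of test functions and hence constant.
\<close>

lemma weak_deriv_imp_ac:
  assumes L: "L > 0" and fg: "has_weak_deriv L f g"
  shows "\<exists>F. has_ac_deriv L F g \<and> (AE x in dom_meas L. f x = F x)"
proof -
  let ?P = "primitive L g"
  have f: "f \<in> L2 L" and g: "g \<in> L2 L" using fg by (auto simp: has_weak_deriv_def)
  note f' = L2_integrable[OF f] and g' = L2_integrable[OF g]
  have P: "has_ac_deriv L ?P g"
    using g' by (simp add: has_ac_deriv_def primitive_left)
  have P_L2: "?P \<in> L2 L" by (intro continuous_in_L2 continuous_on_primitive g')
  have "\<exists>c. AE x in dom_meas L. f x - ?P x = c"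
  proof (rule AE_const_if_test_deriv_integrals_zero[OF L])
    show "integrable (dom_meas L) (\<lambda>x. f x - ?P x)"
      using f' L2_integrable[OF P_L2] by simp
    fix \<phi> assume \<phi>: "test_fun L \<phi>"
    have d: "deriv \<phi> \<in> L2 L" by (intro continuous_in_L2 test_fun_deriv_continuous[OF \<phi>])
    have "bracket L f (deriv \<phi>) = bracket L ?P (deriv \<phi>)"
      using fg \<phi> ac_integration_by_parts_test[OF L P \<phi>] by (simp add: has_weak_deriv_def)
    thus "(LINT x|dom_meas L. (f x - ?P x) * deriv \<phi> x) = 0"
      using L2_mult_integrable[OF f d] L2_mult_integrable[OF P_L2 d]
      by (simp add: bracket_def left_diff_distrib)
  qed
  then obtain c where c: "AE x in dom_meas L. f x - ?P x = c" by blast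
  have "has_ac_deriv L (\<lambda>x. c + ?P x) g"
    using g' by (simp add: has_ac_deriv_def primitive_left)
  moreover have "AE x in dom_meas L. f x = c + ?P x"
    using c by eventually_elim simp
  ultimately show ?thesis by blast
qed

lemma ac_imp_weak_deriv:
  assumes "L > 0" "has_ac_deriv L F g" "g \<in> L2 L"
  shows "has_weak_deriv L F g"
  using assms ac_integration_by_parts_test[OF assms(1,2)]
  by (auto simp: has_weak_deriv_def intro: continuous_in_L2 has_ac_deriv_continuous)

lemma L2_cong_AE:
  assumes "f \<in> L2 L" "f' \<in> borel_measurable (dom_meas L)" "AE x in dom_meas L. f x = f' x"
  shows "f' \<in> L2 L"
proof -
  have "integrable (dom_meas L) (\<lambda>x. (f' x)\<^sup>2)"
  proof (rule integrable_cong_AE_imp[OF L2_square_integrable[OF assms(1)]])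
    show "AE x in dom_meas L. (f x)\<^sup>2 = (f' x)\<^sup>2" using assms(3) by eventually_elim simp
  qed (use assms(2) in auto)
  thus ?thesis using assms(2) by (simp add: L2_def)
qed

lemma has_weak_deriv_cong_AE:
  assumes "has_weak_deriv L f g" "f' \<in> borel_measurable (dom_meas L)" "AE x in dom_meas L. f x = f' x"
  shows "has_weak_deriv L f' g"
proof -
  have f: "f \<in> L2 L" using assms(1) by (simp add: has_weak_deriv_def)
  have "bracket L f' (deriv \<phi>) = bracket L f (deriv \<phi>)" if "test_fun L \<phi>" for \<phi>
    by (rule bracket_cong_AE)
       (use assms f that in \<open>auto simp: L2_measurable eq_commute
          intro: continuous_on_measurable_dom test_fun_deriv_continuous\<close>)
  thus ?thesis
    using assms(1) L2_cong_AE[OF f assms(2,3)] by (simp add: has_weak_deriv_def)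
qed

lemma has_weak_deriv_unique:
  assumes "has_weak_deriv L f g" "has_weak_deriv L f g'"
  shows "AE x in dom_meas L. g x = g' x"
proof -
  have L2: "g \<in> L2 L" "g' \<in> L2 L" using assms by (auto simp: has_weak_deriv_def)
  have "AE x in dom_meas L. g x - g' x = 0"
  proof (rule AE_zero_if_test_integrals_zero)
    show "integrable (dom_meas L) (\<lambda>x. g x - g' x)"
      using L2 by (simp add: L2_integrable)
    fix \<phi> assume \<phi>: "test_fun L \<phi>" "flat_generated \<phi>"
    have "bracket L g \<phi> = bracket L g' \<phi>"
      using assms \<phi>(1) by (auto simp: has_weak_deriv_def)
    thus "(LINT x|dom_meas L. (g x - g' x) * \<phi> x) = 0"
      using integrable_times_flat_generated[OF L2_integrable[OF L2(1)] \<phi>(2)]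
        integrable_times_flat_generated[OF L2_integrable[OF L2(2)] \<phi>(2)]
      by (simp add: bracket_def left_diff_distrib)
  qed
  thus ?thesis by simp
qed

lemma bracket_lincomb_left:
  assumes "f \<in> L2 L" "g \<in> L2 L" "h \<in> L2 L"
  shows "bracket L (\<lambda>x. a * f x + b * g x) h = a * bracket L f h + b * bracket L g h"
proof -
  have "bracket L (\<lambda>x. a * f x + b * g x) h = (LINT x|dom_meas L. a * (f x * h x) + b * (g x * h x))"
    by (simp add: bracket_def algebra_simps)
  thus ?thesis using assms by (simp add: L2_mult_integrable bracket_def)
qed

lemma has_weak_deriv_lincomb:
  assumes "has_weak_deriv L f f'" "has_weak_deriv L g g'"
  shows "has_weak_deriv L (\<lambda>x. a * f x + b * g x) (\<lambda>x. a * f' x + b * g' x)"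
proof -
  have L2: "f \<in> L2 L" "f' \<in> L2 L" "g \<in> L2 L" "g' \<in> L2 L"
    using assms by (auto simp: has_weak_deriv_def)
  have "\<phi> \<in> L2 L" "deriv \<phi> \<in> L2 L" if "test_fun L \<phi>" for \<phi>
    by (intro continuous_in_L2 test_fun_deriv_continuous[OF that]
        has_ac_deriv_continuous[OF test_fun_ac[OF that]])+
  hence "bracket L (\<lambda>x. a * f x + b * g x) (deriv \<phi>) = - bracket L (\<lambda>x. a * f' x + b * g' x) \<phi>"
    if "test_fun L \<phi>" for \<phi>
    using assms L2 that bracket_lincomb_left[of f L g "deriv \<phi>" a b]
      bracket_lincomb_left[of f' L g' \<phi> a b]
    by (simp add: has_weak_deriv_def)
  thus ?thesis using L2 by (simp add: has_weak_deriv_def L2_lincomb)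
qed

lemma H1_wderiv: "f \<in> H1 L \<Longrightarrow> has_weak_deriv L f (wderiv L f)"
  unfolding H1_def wderiv_def mem_Collect_eq by (rule someI_ex[of "has_weak_deriv L f"])

lemma wderiv_AE_eq:
  assumes "has_weak_deriv L f g"
  shows "AE x in dom_meas L. wderiv L f x = g x"
proof -
  have "f \<in> H1 L" using assms by (auto simp: H1_def)
  from has_weak_deriv_unique[OF H1_wderiv[OF this] assms] show ?thesis .
qed

lemma continuous_AE_eq_imp_eq:
  assumes L: "L > 0" and F: "continuous_on {-L..L} F" and G: "continuous_on {-L..L} (G :: real \<Rightarrow> real)"
    and AE: "AE x in dom_meas L. F x = G x" and x: "x \<in> {-L..L}"
  shows "F x = G x"
proof -
  let ?C = "{x \<in> {-L..L}. F x - G x = 0}"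
  have closed: "closed ?C"
    by (intro continuous_closed_preimage_constant continuous_intros F G)
  have "AE x in lebesgue. x \<in> {-L<..<L} \<longrightarrow> F x = G x"
    using AE by (subst (asm) AE_restrict_space_iff) auto
  hence "AE x in lebesgue. x \<in> {-L<..<L} \<longrightarrow> x \<in> ?C"
    by eventually_elim auto
  hence "{-L<..<L} \<subseteq> ?C"
    using mem_closed_if_AE_lebesgue_open[OF open_greaterThanLessThan closed] by (intro subsetI)
  hence "closure {-L<..<L} \<subseteq> ?C" using closed by (rule closure_minimal)
  thus ?thesis using x L by (auto simp: closure_greaterThanLessThan)
qed

text \<open>
  Two continuous functions that agree almost everywhere agree everywhere on the closed interval,
  so the continuous representative that carries the boundary values is the absolutely continuous
  one.
\<close>

lemma H1_ac_rep:
  assumes L: "L > 0" and v: "v \<in> H1 L" and g: "continuous_rep L v g"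
  shows "has_ac_deriv L g (wderiv L v)"
proof -
  obtain F where F: "has_ac_deriv L F (wderiv L v)" "AE x in dom_meas L. v x = F x"
    using weak_deriv_imp_ac[OF L H1_wderiv[OF v]] by blast
  have "AE x in dom_meas L. F x = g x"
    using F(2) g unfolding continuous_rep_def by auto
  hence eq: "F x = g x" if "x \<in> {-L..L}" for x
    using continuous_AE_eq_imp_eq[OF L has_ac_deriv_continuous[OF F(1)] _ _ that] g
    by (auto simp: continuous_rep_def)
  show ?thesis
    unfolding has_ac_deriv_def
  proof (intro conjI ballI)
    fix x assume x: "x \<in> {-L..L}"
    show "g x = g (-L) + primitive L (wderiv L v) x"
      using has_ac_deriv_eq[OF F(1) x] eq[OF x] eq[of "-L"] L by simp
  qed (rule has_ac_deriv_integrable[OF F(1)])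
qed


section \<open>Vanishing of the energy flux\<close>

text \<open>
  With representatives \<open>Q\<close> and \<open>U\<close>, the integrand is almost everywhere the density of \<open>Q U U\<close>,
  which vanishes at \<open>-L\<close> through \<open>U\<close> and at \<open>L\<close> through \<open>Q\<close>.
\<close>

lemma flux_vanishes:
  assumes L: "L > 0" and u: "u \<in> X1 L" and q: "q \<in> X2 L"
  shows "bracket L (\<lambda>x. q x * wderiv L u x + wderiv L (\<lambda>y. q y * u y) x) u = 0"
proof -
  let ?u' = "wderiv L u" and ?q' = "wderiv L q"
  obtain U where U: "continuous_rep L u U" "U (-L) = 0" and uH: "u \<in> H1 L"
    using u by (auto simp: X1_def)
  obtain Q where Q: "continuous_rep L q Q" "Q L = 0" and qH: "q \<in> H1 L"
    using q by (auto simp: X2_def)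
  have U_ac: "has_ac_deriv L U ?u'" by (rule H1_ac_rep[OF L uH U(1)])
  have Q_ac: "has_ac_deriv L Q ?q'" by (rule H1_ac_rep[OF L qH Q(1)])
  note Uc = has_ac_deriv_continuous[OF U_ac] and Qc = has_ac_deriv_continuous[OF Q_ac]
  have L2: "u \<in> L2 L" "q \<in> L2 L" "?u' \<in> L2 L" "?q' \<in> L2 L"
    using H1_wderiv[OF uH] H1_wderiv[OF qH] by (auto simp: has_weak_deriv_def)
  have uU: "AE x in dom_meas L. u x = U x" and qQ: "AE x in dom_meas L. q x = Q x"
    using U Q by (auto simp: continuous_rep_def)
  let ?p = "\<lambda>x. U x * ?q' x + Q x * ?u' x"
  have QU_ac: "has_ac_deriv L (\<lambda>x. Q x * U x) ?p" by (rule has_ac_deriv_mult[OF Q_ac U_ac])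
  have p: "?p \<in> L2 L"
    using L2_lincomb[OF continuous_times_L2[OF Uc L2(4)] continuous_times_L2[OF Qc L2(3)], of 1 1] by simp
  have "has_weak_deriv L (\<lambda>y. q y * u y) ?p"
  proof (rule has_weak_deriv_cong_AE)
    show "has_weak_deriv L (\<lambda>x. Q x * U x) ?p" by (rule ac_imp_weak_deriv[OF L QU_ac p])
    show "(\<lambda>y. q y * u y) \<in> borel_measurable (dom_meas L)"
      using L2 by (intro borel_measurable_times L2_measurable)
    show "AE x in dom_meas L. Q x * U x = q x * u x"
      using uU qQ by eventually_elim simp
  qed
  note w = wderiv_AE_eq[OF this] and qu = this
  have "(\<lambda>y. q y * u y) \<in> H1 L" using qu by (auto simp: H1_def)
  hence wm: "wderiv L (\<lambda>y. q y * u y) \<in> borel_measurable (dom_meas L)"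
    using H1_wderiv unfolding has_weak_deriv_def by (blast intro: L2_measurable)
  have "bracket L (\<lambda>x. q x * ?u' x + wderiv L (\<lambda>y. q y * u y) x) u = bracket L (\<lambda>x. Q x * ?u' x + ?p x) U"
  proof (rule bracket_cong_AE)
    show "AE x in dom_meas L. q x * ?u' x + wderiv L (\<lambda>y. q y * u y) x = Q x * ?u' x + ?p x"
      using w qQ by eventually_elim simp
    show "(\<lambda>x. q x * ?u' x + wderiv L (\<lambda>y. q y * u y) x) \<in> borel_measurable (dom_meas L)"
      by (intro borel_measurable_add borel_measurable_times wm L2_measurable[OF L2(2)] L2_measurable[OF L2(3)])
    show "(\<lambda>x. Q x * ?u' x + ?p x) \<in> borel_measurable (dom_meas L)"
      by (intro borel_measurable_add[OF borel_measurable_times] L2_measurable[OF p]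
          L2_measurable[OF L2(3)] continuous_on_measurable_dom[OF Qc])
  qed (use L2 uU in \<open>auto intro: L2_measurable continuous_on_measurable_dom[OF Uc]\<close>)
  also have "\<dots> = (LINT x|dom_meas L. U x * ?p x + (Q x * U x) * ?u' x)"
    by (simp add: bracket_def algebra_simps)
  also have "\<dots> = Q L * U L * U L - Q (-L) * U (-L) * U (-L)"
    by (rule has_ac_deriv_integral[OF has_ac_deriv_mult[OF QU_ac U_ac] L])
  also have "\<dots> = 0" using U Q by simp
  finally show ?thesis .
qed


section \<open>The time derivative of the energy\<close>

text \<open>
  Young's inequality with a free weight \<open>K\<close>. With \<open>K\<close> a bound for the norm of \<open>r\<close> it bounds the
  bracket by a multiple of \<open>K\<close>, which serves in place of the Cauchy-Schwarz inequality.
\<close>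

lemma bracket_weighted_bound:
  assumes a: "a \<in> L2 L" and r: "r \<in> L2 L" and K: "K > 0"
  shows "2 * \<bar>bracket L a r\<bar> \<le> K * bracket L a a + bracket L r r / K"
proof -
  have pt: "2 * \<bar>a x * r x\<bar> \<le> K * (a x)\<^sup>2 + (r x)\<^sup>2 / K" for x
  proof -
    have "2 * (K * \<bar>a x\<bar>) * \<bar>r x\<bar> \<le> (K * \<bar>a x\<bar>)\<^sup>2 + \<bar>r x\<bar>\<^sup>2"
      by (rule sum_squares_bound)
    thus ?thesis using K by (simp add: field_simps power2_eq_square abs_mult)
  qed
  have int: "integrable (dom_meas L) (\<lambda>x. 2 * \<bar>a x * r x\<bar>)"
    using L2_mult_integrable[OF a r] by simp
  have "2 * \<bar>bracket L a r\<bar> \<le> (LINT x|dom_meas L. 2 * \<bar>a x * r x\<bar>)"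
    unfolding bracket_def using integral_abs_bound[of "dom_meas L" "\<lambda>x. a x * r x"] by simp
  also have "\<dots> \<le> (LINT x|dom_meas L. K * (a x)\<^sup>2 + (r x)\<^sup>2 / K)"
    using a r by (intro integral_mono int pt) (simp add: L2_square_integrable)
  also have "\<dots> = K * bracket L a a + bracket L r r / K"
    using a r by (simp add: L2_square_integrable bracket_def power2_eq_square[symmetric])
  finally show ?thesis .
qed

lemma bracket_self_nonneg: "bracket L f f \<ge> 0"
  unfolding bracket_def by (intro integral_nonneg_AE AE_I2) simp

lemma bracket_commute: "bracket L f g = bracket L g f"
  by (simp add: bracket_def mult.commute)

lemma bracket_lincomb_self:
  assumes "f \<in> L2 L" "g \<in> L2 L"
  shows "bracket L (\<lambda>x. a * f x + b * g x) (\<lambda>x. a * f x + b * g x) =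
    a\<^sup>2 * bracket L f f + 2 * a * b * bracket L f g + b\<^sup>2 * bracket L g g"
proof -
  let ?h = "\<lambda>x. a * f x + b * g x"
  have "bracket L ?h ?h = a * bracket L ?h f + b * bracket L ?h g"
    unfolding bracket_lincomb_left[OF assms L2_lincomb[OF assms]]
    by (simp only: bracket_commute[of L f ?h] bracket_commute[of L g ?h])
  also have "bracket L ?h f = a * bracket L f f + b * bracket L f g"
    using bracket_lincomb_left[OF assms assms(1)] by (simp only: bracket_commute[of L g f])
  also have "bracket L ?h g = a * bracket L f g + b * bracket L g g"
    by (rule bracket_lincomb_left[OF assms assms(2)])
  finally show ?thesis by (simp add: power2_eq_square algebra_simps)
qed

lemma Ham1_eq_bracket: "Ham1 L v = bracket L (wderiv L v) (wderiv L v) / 2"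
  by (simp add: Ham1_def bracket_def power2_eq_square)

text \<open>
  Here \<open>r\<close> is the error of the difference quotient from \<open>u\<close> to \<open>v\<close> with respect to \<open>w\<close>, so that
  \<open>v\<^sub>x = u\<^sub>x + \<delta> (w\<^sub>x + r\<^sub>x)\<close> almost everywhere; expanding the square gives the identity.
\<close>

lemma Ham1_difference_quotient:
  assumes u: "u \<in> H1 L" and v: "v \<in> H1 L" and w: "w \<in> H1 L" and \<delta>: "\<delta> \<noteq> 0"
    and r: "r = (\<lambda>x. (v x - u x) / \<delta> - w x)"
  shows "wderiv L r \<in> L2 L"
    "(Ham1 L v - Ham1 L u) / \<delta> - bracket L (wderiv L w) (wderiv L u) =
      bracket L (wderiv L u) (wderiv L r) +
      \<delta> / 2 * bracket L (\<lambda>x. wderiv L w x + wderiv L r x) (\<lambda>x. wderiv L w x + wderiv L r x)"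
proof -
  let ?u = "wderiv L u" and ?v = "wderiv L v" and ?w = "wderiv L w" and ?r = "wderiv L r"
  have "has_weak_deriv L (\<lambda>x. 1 * ((1/\<delta>) * v x + (-1/\<delta>) * u x) + (-1) * w x)
    (\<lambda>x. 1 * ((1/\<delta>) * ?v x + (-1/\<delta>) * ?u x) + (-1) * ?w x)"
    by (intro has_weak_deriv_lincomb H1_wderiv assms)
  hence r': "has_weak_deriv L r (\<lambda>x. (?v x - ?u x) / \<delta> - ?w x)"
    by (simp add: r diff_divide_distrib)
  have L2: "?u \<in> L2 L" "?v \<in> L2 L" "?w \<in> L2 L"
    using H1_wderiv[OF u] H1_wderiv[OF v] H1_wderiv[OF w] by (auto simp: has_weak_deriv_def)
  have "r \<in> H1 L" using r' by (auto simp: H1_def)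
  thus rL2: "?r \<in> L2 L" using H1_wderiv by (auto simp: has_weak_deriv_def)
  let ?z = "\<lambda>x. ?w x + ?r x"
  have zL2: "?z \<in> L2 L" using L2_lincomb[OF L2(3) rL2, of 1 1] by simp
  have "AE x in dom_meas L. ?v x = 1 * ?u x + \<delta> * ?z x"
    using wderiv_AE_eq[OF r'] by eventually_elim (use \<delta> in \<open>simp add: field_simps\<close>)
  hence "bracket L ?v ?v = bracket L (\<lambda>x. 1 * ?u x + \<delta> * ?z x) (\<lambda>x. 1 * ?u x + \<delta> * ?z x)"
    by (intro bracket_cong_AE L2_measurable L2 L2_lincomb zL2)
  also have "\<dots> = bracket L ?u ?u + 2 * \<delta> * bracket L ?u ?z + \<delta>\<^sup>2 * bracket L ?z ?z"
    using bracket_lincomb_self[OF L2(1) zL2, of 1 \<delta>] by simp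
  also have "bracket L ?u ?z = bracket L ?w ?u + bracket L ?u ?r"
    using bracket_lincomb_left[OF L2(3) rL2 L2(1), of 1 1] by (simp add: bracket_commute)
  finally show "(Ham1 L v - Ham1 L u) / \<delta> - bracket L ?w ?u = bracket L ?u ?r + \<delta> / 2 * bracket L ?z ?z"
    using \<delta> by (simp add: Ham1_eq_bracket field_simps power2_eq_square)
qed

text \<open>
  The derivative of the quadratic form at \<open>u t\<close> in the direction \<open>w\<close>. The error terms of
  \<open>Ham1_difference_quotient\<close> tend to zero because the \<open>H\<^sup>1\<close> norm controls the norm of the weak
  derivative.
\<close>

lemma has_real_derivative_Ham1:
  assumes u: "\<And>s. s \<in> I \<Longrightarrow> u s \<in> H1 L" and t: "t \<in> I"
    and w: "has_X1_time_deriv L u w t I"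
  shows "((\<lambda>s. Ham1 L (u s)) has_real_derivative bracket L (wderiv L w) (wderiv L (u t))) (at t within I)"
proof -
  let ?a = "wderiv L (u t)" and ?b = "wderiv L w"
  define r where "r = (\<lambda>s x. (u s x - u t x) / (s - t) - w x)"
  \<comment> \<open>The summand \<open>\<bar>s - t\<bar>\<close> makes \<open>K s\<close> positive, as the weighted bound requires.\<close>
  define K where "K = (\<lambda>s. H1_norm L (r s) + \<bar>s - t\<bar>)"
  let ?A = "bracket L ?a ?a" and ?B = "bracket L ?b ?b"
  have wH: "w \<in> H1 L" using w by (auto simp: has_X1_time_deriv_def X1_def)
  have L2: "?a \<in> L2 L" "?b \<in> L2 L"
    using H1_wderiv[OF u[OF t]] H1_wderiv[OF wH] by (auto simp: has_weak_deriv_def)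
  have N: "((\<lambda>s. H1_norm L (r s)) \<longlongrightarrow> 0) (at t within I)"
    using w by (simp add: has_X1_time_deriv_def r_def)
  have "((\<lambda>s. \<bar>s - t\<bar>) \<longlongrightarrow> \<bar>t - t\<bar>) (at t within I)" by (intro tendsto_intros)
  hence d: "((\<lambda>s. \<bar>s - t\<bar>) \<longlongrightarrow> 0) (at t within I)" by simp
  have Klim: "(K \<longlongrightarrow> 0) (at t within I)"
    unfolding K_def using tendsto_add[OF N d] by simp
  have bound: "\<bar>(Ham1 L (u s) - Ham1 L (u t)) / (s - t) - bracket L ?b ?a\<bar>
      \<le> K s * (?A + 1) / 2 + \<bar>s - t\<bar> * (?B + (K s)\<^sup>2)"
    if s: "s \<in> I" "s \<noteq> t" for s
  proof -
    let ?r = "wderiv L (r s)" and ?z = "\<lambda>x. ?b x + wderiv L (r s) x"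
    have \<delta>: "s - t \<noteq> 0" using s by simp
    note quot = Ham1_difference_quotient[OF u[OF t] u[OF s(1)] wH \<delta>, of "r s"]
    have rL2: "?r \<in> L2 L" using quot(1) by (simp add: r_def)
    have eq: "(Ham1 L (u s) - Ham1 L (u t)) / (s - t) - bracket L ?b ?a =
        bracket L ?a ?r + (s - t) / 2 * bracket L ?z ?z"
      using quot(2) by (simp add: r_def)
    have N0: "H1_norm L (r s) \<ge> 0"
      by (auto simp: H1_norm_def intro!: add_nonneg_nonneg bracket_self_nonneg)
    hence K: "K s > 0" using s by (simp add: K_def add_nonneg_pos)
    have "bracket L ?r ?r \<le> (H1_norm L (r s))\<^sup>2"
      by (simp add: H1_norm_def bracket_self_nonneg)
    also have "\<dots> \<le> (K s)\<^sup>2" using N0 by (intro power_mono) (auto simp: K_def)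
    finally have rr: "bracket L ?r ?r \<le> (K s)\<^sup>2" .
    have "2 * \<bar>bracket L ?a ?r\<bar> \<le> K s * ?A + bracket L ?r ?r / K s"
      by (rule bracket_weighted_bound[OF L2(1) rL2 K])
    moreover have "bracket L ?r ?r / K s \<le> K s"
      using rr K by (simp add: divide_le_eq power2_eq_square)
    ultimately have 1: "\<bar>bracket L ?a ?r\<bar> \<le> K s * (?A + 1) / 2"
      by (simp add: algebra_simps)
    have "bracket L ?z ?z = ?B + 2 * bracket L ?b ?r + bracket L ?r ?r"
      using bracket_lincomb_self[OF L2(2) rL2, of 1 1] by simp
    moreover have "2 * bracket L ?b ?r \<le> ?B + bracket L ?r ?r"
      using bracket_weighted_bound[OF L2(2) rL2, of 1] by simp
    ultimately have "bracket L ?z ?z / 2 \<le> ?B + (K s)\<^sup>2" using rr by linarith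
    hence "\<bar>s - t\<bar> * (bracket L ?z ?z / 2) \<le> \<bar>s - t\<bar> * (?B + (K s)\<^sup>2)"
      by (intro mult_left_mono) auto
    hence 2: "\<bar>(s - t) / 2 * bracket L ?z ?z\<bar> \<le> \<bar>s - t\<bar> * (?B + (K s)\<^sup>2)"
      using bracket_self_nonneg[of L ?z] by (simp add: abs_mult)
    show ?thesis unfolding eq using 1 2 by linarith
  qed
  have "((\<lambda>s. (Ham1 L (u s) - Ham1 L (u t)) / (s - t) - bracket L ?b ?a) \<longlongrightarrow> 0) (at t within I)"
  proof (rule Lim_null_comparison)
    show "\<forall>\<^sub>F s in at t within I. norm ((Ham1 L (u s) - Ham1 L (u t)) / (s - t) - bracket L ?b ?a)
      \<le> K s * (?A + 1) / 2 + \<bar>s - t\<bar> * (?B + (K s)\<^sup>2)"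
      using bound by (auto simp: eventually_at_filter)
    have "((\<lambda>s. K s * (?A + 1) / 2 + \<bar>s - t\<bar> * (?B + (K s)\<^sup>2)) \<longlongrightarrow> 0 * (?A + 1) / 2 + 0 * (?B + 0\<^sup>2)) (at t within I)"
      by (intro tendsto_intros Klim d) simp
    thus "((\<lambda>s. K s * (?A + 1) / 2 + \<bar>s - t\<bar> * (?B + (K s)\<^sup>2)) \<longlongrightarrow> 0) (at t within I)" by simp
  qed
  thus ?thesis
    unfolding has_field_derivative_iff by (rule LIM_zero_cancel)
qed


section \<open>Conservation of energy\<close>

theorem proposition1:
  fixes L :: real and T :: ereal and I :: "real set"
    and u0 :: "real \<Rightarrow> real"
    and u q u_t :: "real \<Rightarrow> real \<Rightarrow> real"
  assumes "L > 0" and "T > 0"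
    and "I = {t. 0 \<le> t \<and> ereal t < T}"
    and "u0 \<in> X1 L"
    and "\<And>t. t \<in> I \<Longrightarrow> u t \<in> X1 L"
    and "\<And>t. t \<in> I \<Longrightarrow> q t \<in> X2 L"
    and "AE x in dom_meas L. u 0 x = u0 x"
    and "\<And>t. t \<in> I \<Longrightarrow> has_X1_time_deriv L u (u_t t) t I"
    and "\<And>t v1. t \<in> I \<Longrightarrow> v1 \<in> X1 L \<Longrightarrow>
      bracket L (wderiv L (u_t t)) (wderiv L v1) =
      bracket L (\<lambda>x. q t x * wderiv L (u t) x + wderiv L (\<lambda>y. q t y * u t y) x) v1"
    and "\<And>t v2. t \<in> I \<Longrightarrow> v2 \<in> X2 L \<Longrightarrow>
      bracket L (q t) v2 = - bracket L (wderiv L (u t)) (wderiv L v2)"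
  shows "\<forall>t\<in>I. ((\<lambda>s. Ham1 L (u s)) has_real_derivative 0) (at t within I)"
proof
  fix t assume t: "t \<in> I"
  have "((\<lambda>s. Ham1 L (u s)) has_real_derivative
      bracket L (wderiv L (u_t t)) (wderiv L (u t))) (at t within I)"
    using assms(5) by (intro has_real_derivative_Ham1 t assms(8)) (simp add: X1_def)
  moreover have "bracket L (wderiv L (u_t t)) (wderiv L (u t)) = 0"
    using assms(9)[OF t assms(5)[OF t]] flux_vanishes[OF assms(1) assms(5)[OF t] assms(6)[OF t]]
    by simp
  ultimately show "((\<lambda>s. Ham1 L (u s)) has_real_derivative 0) (at t within I)" by simp
qed

end
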